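(* Let $(\mathfrak h,[-,-]_{\mathfrak h},\rhd)$ be a Leibniz-Lie algebra. Then the binary operation $[-,-]:\mathfrak h\otimes\mathfrak h\to\mathfrak h$ given by $$[x,y]=x\rhd y+[x,y]_{\mathfrak h},\qquad\forall x,y\in\mathfrak h,$$ defines a Leibniz algebra structure on $\mathfrak h$. Moreover, define $\mathcal L:\mathfrak h\to\mathfrak{gl}(\mathfrak h)$ by $\mathcal L_xy=x\rhd y$. Then $(\mathfrak h;\mathcal L,0)$ is a representation of the Leibniz algebra $(\mathfrak h,[-,-])$ on $\mathfrak h$.
   Context: All vector spaces are over a fixed ground field. A Leibniz-Lie algebra $(\mathfrak h,[-,-]_{\mathfrak h},\rhd)$ consists of a Lie algebra $(\mathfrak h,[-,-]_{\mathfrak h})$ and a bilinear product $\rhd:\mathfrak h\otimes\mathfrak h\to\mathfrak h$ such that for all $x,y,z\in\mathfrak h$: $x\rhd(y\rhd z)=(x\rhd y)\rhd z+y\rhd(x\rhd z)+[x,y]_{\mathfrak h}\rhd z$ and $x\rhd[y,z]_{\mathfrak h}=[x\rhd y,z]_{\mathfrak h}=0$. A Leibniz algebra is a vector space $\mathfrak G$ with a bilinear bracket satisfying $[x,[y,z]]=[[x,y],z]+[y,[x,z]]$ for all $x,y,z$. A representation of a Leibniz algebra $(\mathfrak G,[-,-]_{\mathfrak G})$ is a triple $(V;\rho^L,\rho^R)$, where $V$ is a vector space and $\rho^L,\rho^R:\mathfrak G\to\mathfrak{gl}(V)$ are linear maps such that for all $x,y\in\mathfrak G$: $\rho^L([x,y]_{\mathfrak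 G})=[\rho^L(x),\rho^L(y)]$, $\rho^R([x,y]_{\mathfrak G})=[\rho^L(x),\rho^R(y)]$, and $\rho^R(y)\circ\rho^L(x)=-\rho^R(y)\circ\rho^R(x)$, the brackets on the right being commutators in $\mathfrak{gl}(V)$. *)

theory Defs
  imports Complex_Main "HOL-Library.Function_Algebras"
begin

definition bilinear_product ::
  "('k::field \<Rightarrow> 'v::ab_group_add \<Rightarrow> 'v) \<Rightarrow> ('v \<Rightarrow> 'v \<Rightarrow> 'v) \<Rightarrow> bool"
  where "bilinear_product scale p \<longleftrightarrow>
    (\<forall>x. Vector_Spaces.linear scale scale (\<lambda>y. p x y)) \<and>
    (\<forall>y. Vector_Spaces.linear scale scale (\<lambda>x. p x y))"

text \<open>The ground field is arbitrary, so the bracket of a Lie algebra is required to be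
  alternating; in characteristic 2 skew-symmetry alone would be weaker.\<close>

locale lie_algebra = vector_space scale
  for scale :: "'k::field \<Rightarrow> 'v::ab_group_add \<Rightarrow> 'v" +
  fixes lie :: "'v \<Rightarrow> 'v \<Rightarrow> 'v"
  assumes lie_bilinear: "bilinear_product scale lie"
    and lie_alternating: "lie x x = 0"
    and lie_jacobi: "lie x (lie y z) + lie y (lie z x) + lie z (lie x y) = 0"

locale leibniz_lie_algebra = lie_algebra scale lie
  for scale :: "'k::field \<Rightarrow> 'v::ab_group_add \<Rightarrow> 'v"
    and lie :: "'v \<Rightarrow> 'v \<Rightarrow> 'v" +
  fixes rprod :: "'v \<Rightarrow> 'v \<Rightarrow> 'v" (infixl "\<rhd>" 70)
  assumes rprod_bilinear: "bilinear_product scale (\<rhd>)"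
    and rprod_rprod: "x \<rhd> (y \<rhd> z) = (x \<rhd> y) \<rhd> z + y \<rhd> (x \<rhd> z) + lie x y \<rhd> z"
    and rprod_lie: "x \<rhd> lie y z = 0"
    and lie_rprod: "lie (x \<rhd> y) z = 0"

locale leibniz_algebra = vector_space scale
  for scale :: "'k::field \<Rightarrow> 'g::ab_group_add \<Rightarrow> 'g" +
  fixes bracket :: "'g \<Rightarrow> 'g \<Rightarrow> 'g"
  assumes bracket_bilinear: "bilinear_product scale bracket"
    and leibniz_identity:
      "bracket x (bracket y z) = bracket (bracket x y) z + bracket y (bracket x z)"

text \<open>Endomorphisms are plain functions; sums, differences, negation and zero of functions are
  the pointwise ones of \<^theory>\<open>HOL-Library.Function_Algebras\<close>.\<close>

definition gl :: "('k::field \<Rightarrow> 'v::ab_group_add \<Rightarrow> 'v) \<Rightarrow> ('v \<Rightarrow> 'v) set"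
  where "gl scale = {f. Vector_Spaces.linear scale scale f}"

definition scale_fun :: "('k::field \<Rightarrow> 'v::ab_group_add \<Rightarrow> 'v) \<Rightarrow> 'k \<Rightarrow> ('v \<Rightarrow> 'v) \<Rightarrow> 'v \<Rightarrow> 'v"
  where "scale_fun scale c f = (\<lambda>v. scale c (f v))"

definition commutator :: "('v::ab_group_add \<Rightarrow> 'v) \<Rightarrow> ('v \<Rightarrow> 'v) \<Rightarrow> 'v \<Rightarrow> 'v"
  where "commutator f g = (f \<circ> g) - (g \<circ> f)"

text \<open>A linear map into \<open>gl\<close> is a map with values in \<open>gl\<close> that is linear into the vector
  space of all functions, of which \<open>gl\<close> is a subspace.\<close>

locale leibniz_representation =
  leibniz_algebra scaleG bracket + V: vector_space scaleV
  for scaleG :: "'k::field \<Rightarrow> 'g::ab_group_add \<Rightarrow> 'g"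
    and bracket :: "'g \<Rightarrow> 'g \<Rightarrow> 'g"
    and scaleV :: "'k \<Rightarrow> 'v::ab_group_add \<Rightarrow> 'v" +
  fixes rhoL rhoR :: "'g \<Rightarrow> 'v \<Rightarrow> 'v"
  assumes rhoL_gl: "rhoL x \<in> gl scaleV"
    and rhoR_gl: "rhoR x \<in> gl scaleV"
    and rhoL_linear: "Vector_Spaces.linear scaleG (scale_fun scaleV) rhoL"
    and rhoR_linear: "Vector_Spaces.linear scaleG (scale_fun scaleV) rhoR"
    and rhoL_bracket: "rhoL (bracket x y) = commutator (rhoL x) (rhoL y)"
    and rhoR_bracket: "rhoR (bracket x y) = commutator (rhoL x) (rhoR y)"
    and rhoR_rhoL: "rhoR y \<circ> rhoL x = - (rhoR y \<circ> rhoR x)"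

end

theory Submission
  imports Defs
begin

text \<open>
  Expand both sides of the Leibniz identity for \<open>[x, y] = x \<rhd> y + [x, y]\<^sub>\<hh>\<close>. The mixed terms
  \<open>x \<rhd> [y, z]\<^sub>\<hh>\<close> and \<open>[x \<rhd> y, z]\<^sub>\<hh>\<close> vanish by the axioms, and \<open>[x, y \<rhd> z]\<^sub>\<hh>\<close> vanishes because
  the Lie bracket is skew-symmetric. What is left falls into two parts with no interaction: the
  terms in \<open>\<rhd>\<close> balance by the defining identity of a Leibniz-Lie algebra, in which the extra term
  \<open>[x, y]\<^sub>\<hh> \<rhd> z\<close> is the contribution of the Lie part of \<open>[x, y]\<close> acting by \<open>\<rhd>\<close>, and the iterated
  Lie brackets balance by the Jacobi identity in its derivation form.

  The same defining identity, read as an identity of operators applied to \<open>z\<close>, is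
  \<open>\<L>\<^bsub>[x, y]\<^esub> = \<L>\<^sub>x \<L>\<^sub>y - \<L>\<^sub>y \<L>\<^sub>x\<close>. Of the three compatibility identities of a
  representation it is the one with content: the other two compare maps that vanish because the
  right action is zero.
\<close>

lemma linear_iff_vector_space:
  "Vector_Spaces.linear s1 s2 f \<longleftrightarrow> vector_space s1 \<and> vector_space s2 \<and>
    (\<forall>x y. f (x + y) = f x + f y) \<and> (\<forall>c x. f (s1 c x) = s2 c (f x))"
  unfolding Vector_Spaces.linear_def module_hom_def module_hom_axioms_def
  by (auto simp: module_iff_vector_space)

lemma bilinear_product_iff:
  "bilinear_product scale p \<longleftrightarrow> vector_space scale \<and>
    (\<forall>x y z. p x (y + z) = p x y + p x z) \<and> (\<forall>x y z. p (x + y) z = p x z + p y z) \<and>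
    (\<forall>c x y. p x (scale c y) = scale c (p x y)) \<and> (\<forall>c x y. p (scale c x) y = scale c (p x y))"
  unfolding bilinear_product_def linear_iff_vector_space by blast

lemma bilinear_product_add:
  assumes "bilinear_product scale p" and "bilinear_product scale q"
  shows "bilinear_product scale (\<lambda>x y. p x y + q x y)"
proof -
  interpret vector_space scale
    using assms(1) by (simp add: bilinear_product_iff)
  show ?thesis
    using assms by (simp add: bilinear_product_iff scale_right_distrib)
qed

lemma vector_space_scale_fun:
  assumes "vector_space scale"
  shows "vector_space (scale_fun scale)"
proof -
  interpret vector_space scale by fact
  show ?thesis
    by unfold_locales
      (auto simp: scale_fun_def fun_eq_iff scale_right_distrib scale_left_distrib)
qed

context lie_algebra
begin

lemma lie_add_left: "lie (x + y) z = lie x z + lie y z"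
  and lie_add_right: "lie x (y + z) = lie x y + lie x z"
  using lie_bilinear by (simp_all add: bilinear_product_iff)

text \<open>Polarisation: expand \<open>[x + y, x + y] = 0\<close>.\<close>

lemma lie_skew: "lie x y = - lie y x"
proof -
  have "lie x y + lie y x = lie (x + y) (x + y)"
    unfolding lie_add_left lie_add_right by (simp add: lie_alternating)
  also have "\<dots> = 0"
    by (rule lie_alternating)
  finally have "lie x y + lie y x = 0" .
  then show ?thesis
    by (simp only: eq_neg_iff_add_eq_0)
qed

lemma lie_minus_right: "lie x (- y) = - lie x y"
  using lie_add_right[of x y "- y"] lie_add_right[of x 0 0]
  by (simp add: eq_neg_iff_add_eq_0 add.commute)

text \<open>The derivation form is the one that matches the Leibniz identity term by term.\<close>

lemma lie_derivation: "lie x (lie y z) = lie (lie x y) z + lie y (lie x z)"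
proof -
  have "lie y (lie z x) = - lie y (lie x z)"
    by (metis lie_skew lie_minus_right)
  moreover have "lie z (lie x y) = - lie (lie x y) z"
    by (rule lie_skew)
  ultimately show ?thesis
    using lie_jacobi[of x y z] by (simp add: algebra_simps)
qed

end

context leibniz_lie_algebra
begin

lemma rprod_add_left: "(x + y) \<rhd> z = x \<rhd> z + y \<rhd> z"
  and rprod_add_right: "x \<rhd> (y + z) = x \<rhd> y + x \<rhd> z"
  and rprod_scale_left: "scale c x \<rhd> y = scale c (x \<rhd> y)"
  and rprod_scale_right: "x \<rhd> scale c y = scale c (x \<rhd> y)"
  using rprod_bilinear by (simp_all add: bilinear_product_iff)

text \<open>Only the left slot of the bracket is covered by the axioms; skew-symmetry transfers it.\<close>

lemma lie_rprod_right: "lie x (y \<rhd> z) = 0"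
  using lie_skew[of x "y \<rhd> z"] by (simp add: lie_rprod)

lemma leibniz_algebra_rprod_plus_lie:
  "leibniz_algebra scale (\<lambda>x y. x \<rhd> y + lie x y)"
proof unfold_locales
  show "bilinear_product scale (\<lambda>x y. x \<rhd> y + lie x y)"
    by (rule bilinear_product_add[OF rprod_bilinear lie_bilinear])
next
  fix x y z
  show "x \<rhd> (y \<rhd> z + lie y z) + lie x (y \<rhd> z + lie y z)
      = ((x \<rhd> y + lie x y) \<rhd> z + lie (x \<rhd> y + lie x y) z)
        + (y \<rhd> (x \<rhd> z + lie x z) + lie y (x \<rhd> z + lie x z))"
    using rprod_rprod[of x y z] lie_derivation[of x y z]
    by (simp add: rprod_add_left rprod_add_right lie_add_left lie_add_right
        rprod_lie lie_rprod lie_rprod_right)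
qed

lemma rprod_commutator: "(\<rhd>) (x \<rhd> y + lie x y) = commutator ((\<rhd>) x) ((\<rhd>) y)"
proof
  fix z
  show "(x \<rhd> y + lie x y) \<rhd> z = commutator ((\<rhd>) x) ((\<rhd>) y) z"
    using rprod_rprod[of x y z] by (simp add: commutator_def rprod_add_left)
qed

lemma leibniz_representation_rprod_zero:
  "leibniz_representation scale (\<lambda>x y. x \<rhd> y + lie x y) scale (\<rhd>) 0"
proof -
  have vs: "vector_space scale" ..
  have rprod_zero: "x \<rhd> 0 = 0" for x
    using rprod_add_right[of x 0 0] by simp
  show ?thesis
  proof (intro leibniz_representation.intro leibniz_representation_axioms.intro)
    show "leibniz_algebra scale (\<lambda>x y. x \<rhd> y + lie x y)"
      by (rule leibniz_algebra_rprod_plus_lie)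
    show "vector_space scale"
      by (rule vs)
    fix x y
    show "(\<rhd>) x \<in> gl scale"
      by (simp add: gl_def linear_iff_vector_space vs rprod_add_right rprod_scale_right)
    show "0 x \<in> gl scale"
      by (simp add: gl_def linear_iff_vector_space vs)
    show "Vector_Spaces.linear scale (scale_fun scale) (\<rhd>)"
      by (simp add: linear_iff_vector_space vs vector_space_scale_fun fun_eq_iff
          rprod_add_left rprod_scale_left scale_fun_def)
    show "Vector_Spaces.linear scale (scale_fun scale) 0"
      by (simp add: linear_iff_vector_space vs vector_space_scale_fun fun_eq_iff scale_fun_def)
    show "(\<rhd>) (x \<rhd> y + lie x y) = commutator ((\<rhd>) x) ((\<rhd>) y)"
      by (rule rprod_commutator)
    show "0 (x \<rhd> y + lie x y) = commutator ((\<rhd>) x) (0 y)"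
      by (simp add: commutator_def fun_eq_iff rprod_zero)
    show "0 y \<circ> (\<rhd>) x = - ((0 y :: 'v \<Rightarrow> 'v) \<circ> 0 x)"
      by (simp add: fun_eq_iff)
  qed
qed

end

theorem theorem3p4:
  fixes scale :: "'k::field \<Rightarrow> 'h::ab_group_add \<Rightarrow> 'h"
    and lie :: "'h \<Rightarrow> 'h \<Rightarrow> 'h"
    and rprod :: "'h \<Rightarrow> 'h \<Rightarrow> 'h" (infixl "\<rhd>" 70)
    and bracket :: "'h \<Rightarrow> 'h \<Rightarrow> 'h"
    and L :: "'h \<Rightarrow> 'h \<Rightarrow> 'h"
  assumes "leibniz_lie_algebra scale lie (\<rhd>)"
    and "\<And>x y. bracket x y = x \<rhd> y + lie x y"
    and "\<And>x y. L x y = x \<rhd> y"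
  shows "leibniz_algebra scale bracket \<and>
    leibniz_representation scale bracket scale L 0"
proof -
  have "bracket = (\<lambda>x y. x \<rhd> y + lie x y)" and "L = (\<rhd>)"
    using assms(2,3) by (simp_all add: fun_eq_iff)
  then show ?thesis
    using leibniz_lie_algebra.leibniz_algebra_rprod_plus_lie[OF assms(1)]
      leibniz_lie_algebra.leibniz_representation_rprod_zero[OF assms(1)]
    by simp
qed

end
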